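(* There is an absolute constant $C$ such that the following holds. For each integer $n\ge 3$, let $\Delta(n)$ be any natural number satisfying $2\le\Delta(n)<n$. Then there exists a family of graphs $G(n)$, where $G(n)$ has $n$ vertices and maximum degree $\Delta(n)$, and for each $n$ an associated (discrete-time) Glauber dynamics on $G(n)$ whose mixing time is at most $C\,n\log n/\log\Delta(n)$.
   Context: Setting. $G=(V,E)$ is a finite undirected graph with $n=|V|$ vertices (called sites), $Q=\{1,\dots,q\}$ is a finite set of spins (any finite set of labels may be used), and $\Omega\subseteq Q^V$ is an arbitrary set of configurations $\sigma:V\to Q$, called feasible. A Glauber dynamics on $G$ is a Markov chain on $\Omega$ which, in configuration $\sigma\in\Omega$, does the following at each step: (1) picks a site $v\in V$ uniformly at random; (2) replaces the spin $s=\sigma(v)$ by a new spin $s'$ chosen with probability $\kappa_{\sigma,v}(s,s')$, resulting in a new feasible configuration $\sigma'$ (which agrees with $\sigma$ off $v$ and has $\sigma'(v)=s'$). The update distributions $\kappa_{\sigma,v}(s,\cdot)$ are required to be: - local: $\kappa_{\sigma,v}(s,\cdot)$ depends only on the values of $\sigma$ at $v$ and at the neighbors of $v$ in $G$; - reversible with respect to some probability distribution $\pi$ with $\pi(\sigma)>0$ for all $\sigma\in\Omega$: $\pi(\sigma)\kappa_{\sigma,v}(s,s')=\pi(\sigma')\kappa_{\sigma',v}(s',s)$ for all such $\sigma,\sigma',v$ with $s=\sigma(v)$, $s'=\sigma'(v)$. Every Glauber dynamics, with transition matrix $P$, is also required to be irreducible (for all $\sigma,\tau\in\Omega$ there is a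 finite $t$ with $P^t(\sigma,\tau)>0$), aperiodic ($\gcd\{t:P^t(\sigma,\tau)>0\}=1$ for all $\sigma,\tau\in\Omega$), and nonredundant (for every site $v$ at least two distinct spin values appear at $v$ in feasible configurations). Mixing time: $\tau_{\mathrm{mix}}=\max_{X_0\in\Omega}\min\{t:\|X_t-\pi\|\le \frac1{2e}\}$, where $(X_t)_{t\ge0}$ is the dynamics started at $X_0$, $X_t$ is identified with its distribution, and $\|\mu-\eta\|=\frac12\sum_{z\in\Omega}|\mu(z)-\eta(z)|$ is total variation distance. *)

theory Defs
  imports
    "HOL-Probability.Probability"
    "Graph_Theory.Pair_Digraph"
begin

text \<open>
  Finite simple undirected graphs are the symmetric, loop-free pair digraphs of the locale
  \<^locale>\<open>pair_graph\<close>: every undirected edge is represented by its two arcs, so that the out-degree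
  of a vertex is its number of neighbours.
\<close>

definition max_degree :: "'v pair_pre_digraph \<Rightarrow> nat" where
  "max_degree G = Max (out_degree (with_proj G) ` pverts G)"

text \<open>
  \<open>\<kappa> \<sigma> v s\<close> is the distribution of the new spin when the site \<open>v\<close>, whose current spin is \<open>s = \<sigma> v\<close>,
  is updated in the configuration \<open>\<sigma>\<close>. Only the values with \<open>s = \<sigma> v\<close> are meaningful.
\<close>

type_synonym ('v, 's) update_kernel = "('v \<Rightarrow> 's) \<Rightarrow> 'v \<Rightarrow> 's \<Rightarrow> 's pmf"

definition glauber_step ::
    "'v pair_pre_digraph \<Rightarrow> ('v, 's) update_kernel \<Rightarrow> ('v \<Rightarrow> 's) \<Rightarrow> ('v \<Rightarrow> 's) pmf" where
  "glauber_step G \<kappa> \<sigma> =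
     bind_pmf (pmf_of_set (pverts G)) (\<lambda>v. map_pmf (\<lambda>s'. \<sigma>(v := s')) (\<kappa> \<sigma> v (\<sigma> v)))"

text \<open>
  The distribution of \<open>X\<^sub>t\<close> given \<open>X\<^sub>0 = \<sigma>\<close>; thus \<open>P\<^sup>t(\<sigma>, \<tau>)\<close> is \<open>pmf (glauber_dist G \<kappa> \<sigma> t) \<tau>\<close>.
\<close>

definition glauber_dist ::
    "'v pair_pre_digraph \<Rightarrow> ('v, 's) update_kernel \<Rightarrow> ('v \<Rightarrow> 's) \<Rightarrow> nat \<Rightarrow> ('v \<Rightarrow> 's) pmf" where
  "glauber_dist G \<kappa> \<sigma> t = ((\<lambda>\<mu>. bind_pmf \<mu> (glauber_step G \<kappa>)) ^^ t) (return_pmf \<sigma>)"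

text \<open>
  Configurations are extensional functions on the vertex set, so that they are in bijection with
  the functions \<open>V \<rightarrow> Q\<close>.
\<close>

locale glauber_dynamics = pair_graph G
  for G :: "'v pair_pre_digraph" +
  fixes Q :: "'s set"
    and \<Omega> :: "('v \<Rightarrow> 's) set"
    and \<kappa> :: "('v, 's) update_kernel"
    and \<pi> :: "('v \<Rightarrow> 's) pmf"
  assumes sites_nonempty: "pverts G \<noteq> {}"
    and finite_spins: "finite Q"
    and configurations: "\<Omega> \<subseteq> pverts G \<rightarrow>\<^sub>E Q"
    and feasible:
      "\<lbrakk>\<sigma> \<in> \<Omega>; v \<in> pverts G; s' \<in> set_pmf (\<kappa> \<sigma> v (\<sigma> v))\<rbrakk> \<Longrightarrow> \<sigma>(v := s') \<in> \<Omega>"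
    and locality:
      "\<lbrakk>\<sigma> \<in> \<Omega>; \<sigma>' \<in> \<Omega>; v \<in> pverts G; \<sigma> v = \<sigma>' v; \<And>w. (v, w) \<in> parcs G \<Longrightarrow> \<sigma> w = \<sigma>' w\<rbrakk>
        \<Longrightarrow> \<kappa> \<sigma> v (\<sigma> v) = \<kappa> \<sigma>' v (\<sigma>' v)"
    and support: "set_pmf \<pi> = \<Omega>"
    and reversible:
      "\<lbrakk>\<sigma> \<in> \<Omega>; \<sigma>' \<in> \<Omega>; v \<in> pverts G; \<And>w. w \<noteq> v \<Longrightarrow> \<sigma>' w = \<sigma> w\<rbrakk>
        \<Longrightarrow> pmf \<pi> \<sigma> * pmf (\<kappa> \<sigma> v (\<sigma> v)) (\<sigma>' v) = pmf \<pi> \<sigma>' * pmf (\<kappa> \<sigma>' v (\<sigma>' v)) (\<sigma> v)"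
    and irreducible:
      "\<lbrakk>\<sigma> \<in> \<Omega>; \<tau> \<in> \<Omega>\<rbrakk> \<Longrightarrow> \<exists>t. pmf (glauber_dist G \<kappa> \<sigma> t) \<tau> > 0"
    and aperiodic:
      "\<lbrakk>\<sigma> \<in> \<Omega>; \<tau> \<in> \<Omega>\<rbrakk> \<Longrightarrow> Gcd {t. pmf (glauber_dist G \<kappa> \<sigma> t) \<tau> > 0} = 1"
    and nonredundant:
      "v \<in> pverts G \<Longrightarrow> \<exists>\<sigma>\<in>\<Omega>. \<exists>\<tau>\<in>\<Omega>. \<sigma> v \<noteq> \<tau> v"

definition tv_dist :: "'a set \<Rightarrow> 'a pmf \<Rightarrow> 'a pmf \<Rightarrow> real" where
  "tv_dist A \<mu> \<eta> = (1 / 2) * (\<Sum>z\<in>A. \<bar>pmf \<mu> z - pmf \<eta> z\<bar>)"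

text \<open>
  For a Glauber dynamics \<open>\<Omega>\<close> is finite and nonempty, and by convergence to \<open>\<pi>\<close> the minima exist.
\<close>

definition mixing_time ::
    "'v pair_pre_digraph \<Rightarrow> ('v \<Rightarrow> 's) set \<Rightarrow> ('v, 's) update_kernel \<Rightarrow> ('v \<Rightarrow> 's) pmf \<Rightarrow> nat" where
  "mixing_time G \<Omega> \<kappa> \<pi> =
     Max ((\<lambda>\<sigma>. LEAST t. tv_dist \<Omega> (glauber_dist G \<kappa> \<sigma> t) \<pi> \<le> 1 / (2 * exp 1)) ` \<Omega>)"

end

theory Submission
  imports Defs
begin

text \<open>
  For \<open>\<Delta> \<ge> 3\<close> take a balanced tree whose vertices have about \<open>\<Delta> - 1\<close> children, hence of depth
  \<open>O(log n / log \<Delta>)\<close>. The feasible configurations are paths of pointers descending from the root: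
  a site may be occupied only if its parent points to it. A site is resampled iff its parent points
  to it (or it is the root) and its children are unoccupied; the new spin is empty with probability
  at least \<open>15/16\<close>. This is reversible with respect to a product measure conditioned on the feasible
  configurations. Weight a disagreement at a site of depth \<open>d\<close> by \<open>2 ^ d\<close>. A disagreement heals with
  probability \<open>1 / n\<close>, while the strong bias towards the empty spin and the smaller weight of the
  parent limit its propagation, so that weighted Lipschitz constants contract by \<open>1 - 1 / (4 n)\<close> in
  every step. The weighted diameter is \<open>O(2 ^ depth)\<close>, so \<open>O(n \<cdot> depth)\<close> steps suffice.
  For \<open>\<Delta> = 2\<close> every site is made a root of its own: the sites are then independent and the
  diameter is \<open>O(n)\<close>.
\<close>

section \<open>Weighted contraction bounds the mixing time\<close>

text \<open>Following test functions along single-site moves is the dual form of path coupling in a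
  weighted Hamming metric, so no coupling has to be constructed. Only moves between two feasible
  configurations are measured.\<close>

definition site_lipschitz ::
    "'v set \<Rightarrow> ('v \<Rightarrow> 's) set \<Rightarrow> ('v \<Rightarrow> real) \<Rightarrow> real \<Rightarrow> (('v \<Rightarrow> 's) \<Rightarrow> real) \<Rightarrow> bool" where
  "site_lipschitz V \<Omega> w L f \<longleftrightarrow>
     (\<forall>\<sigma>\<in>\<Omega>. \<forall>\<tau>\<in>\<Omega>. \<forall>u\<in>V. (\<forall>v. v \<noteq> u \<longrightarrow> \<sigma> v = \<tau> v) \<longrightarrow> \<bar>f \<sigma> - f \<tau>\<bar> \<le> L * w u)"

lemma site_lipschitzD:
  assumes "site_lipschitz V \<Omega> w L f" "\<sigma> \<in> \<Omega>" "\<tau> \<in> \<Omega>" "u \<in> V" "\<And>v. v \<noteq> u \<Longrightarrow> \<sigma> v = \<tau> v"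
  shows "\<bar>f \<sigma> - f \<tau>\<bar> \<le> L * w u"
  using assms unfolding site_lipschitz_def by blast

lemma pmf_map_fun_upd:
  "pmf (map_pmf (\<lambda>s. \<sigma>(v := s)) p) \<tau> = (if \<forall>w. w \<noteq> v \<longrightarrow> \<tau> w = \<sigma> w then pmf p (\<tau> v) else 0)"
proof (cases "\<forall>w. w \<noteq> v \<longrightarrow> \<tau> w = \<sigma> w")
  case True
  then have "\<tau> = \<sigma>(v := \<tau> v)" by auto
  moreover have "inj (\<lambda>s. \<sigma>(v := s))" by (rule injI) (metis fun_upd_same)
  ultimately show ?thesis using True by (metis pmf_map_inj')
next
  case False
  then have "\<tau> \<notin> (\<lambda>s. \<sigma>(v := s)) ` set_pmf p" by auto
  then show ?thesis using False by (auto simp: pmf_eq_0_set_pmf)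
qed

lemma abs_expectation_diff_le:
  fixes f g :: "'a \<Rightarrow> real"
  assumes "finite (set_pmf p)" "\<And>x. x \<in> set_pmf p \<Longrightarrow> \<bar>f x - g x\<bar> \<le> h x"
  shows "\<bar>measure_pmf.expectation p f - measure_pmf.expectation p g\<bar> \<le> measure_pmf.expectation p h"
proof -
  have i: "integrable p k" for k :: "'a \<Rightarrow> real" using assms(1) by (rule integrable_measure_pmf_finite)
  have "\<bar>measure_pmf.expectation p f - measure_pmf.expectation p g\<bar>
      = \<bar>measure_pmf.expectation p (\<lambda>x. f x - g x)\<bar>"
    by (simp add: i)
  also have "\<dots> \<le> measure_pmf.expectation p (\<lambda>x. \<bar>f x - g x\<bar>)"
    by (rule integral_abs_bound)
  also have "\<dots> \<le> measure_pmf.expectation p h"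
    using assms(2) by (intro integral_mono_AE i) (auto simp: AE_measure_pmf_iff)
  finally show ?thesis .
qed

section \<open>Finiteness, one-step expectations and stationarity\<close>

context glauber_dynamics
begin

abbreviation expect_step :: "(('v \<Rightarrow> 's) \<Rightarrow> real) \<Rightarrow> ('v \<Rightarrow> 's) \<Rightarrow> real" where
  "expect_step f \<sigma> \<equiv> measure_pmf.expectation (glauber_step G \<kappa> \<sigma>) f"

lemma finite_verts: "finite (pverts G)"
  by (rule pair_finite_verts)

lemma finite_configurations: "finite \<Omega>"
  using configurations finite_PiE[OF finite_verts finite_spins] by (meson finite_subset)

lemma configurations_nonempty: "\<Omega> \<noteq> {}"
  using support set_pmf_not_empty by metis

lemma set_glauber_step:
  "set_pmf (glauber_step G \<kappa> \<sigma>) = (\<Union>v\<in>pverts G. (\<lambda>s. \<sigma>(v := s)) ` set_pmf (\<kappa> \<sigma> v (\<sigma> v)))"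
  unfolding glauber_step_def using finite_verts sites_nonempty by simp

lemma set_glauber_step_subset: "\<sigma> \<in> \<Omega> \<Longrightarrow> set_pmf (glauber_step G \<kappa> \<sigma>) \<subseteq> \<Omega>"
  using feasible by (auto simp: set_glauber_step)

lemma glauber_dist_Suc:
  "glauber_dist G \<kappa> \<sigma> (Suc t) = bind_pmf (glauber_dist G \<kappa> \<sigma> t) (glauber_step G \<kappa>)"
  by (simp add: glauber_dist_def)

lemma set_glauber_dist_subset:
  assumes "\<sigma> \<in> \<Omega>"
  shows "set_pmf (glauber_dist G \<kappa> \<sigma> t) \<subseteq> \<Omega>"
proof (induction t)
  case 0
  show ?case using assms by (simp add: glauber_dist_def)
next
  case (Suc t)
  then show ?case using set_glauber_step_subset unfolding glauber_dist_Suc by fastforce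
qed

text \<open>Feasibility makes \<open>s \<mapsto> \<sigma>(v := s)\<close> an injection of the
  support into the finite set \<open>\<Omega>\<close>.\<close>

lemma finite_set_kernel:
  assumes "\<sigma> \<in> \<Omega>" "v \<in> pverts G"
  shows "finite (set_pmf (\<kappa> \<sigma> v (\<sigma> v)))"
proof (rule finite_imageD)
  show "finite ((\<lambda>s. \<sigma>(v := s)) ` set_pmf (\<kappa> \<sigma> v (\<sigma> v)))"
    using feasible[OF assms] finite_configurations by (auto intro: finite_subset)
  show "inj_on (\<lambda>s. \<sigma>(v := s)) (set_pmf (\<kappa> \<sigma> v (\<sigma> v)))"
    by (rule inj_onI) (metis fun_upd_same)
qed

lemma expectation_bind_step:
  assumes "set_pmf \<mu> \<subseteq> \<Omega>"
  shows "measure_pmf.expectation (bind_pmf \<mu> (glauber_step G \<kappa>)) f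
       = measure_pmf.expectation \<mu> (expect_step f)"
proof -
  have "measure_pmf.expectation (bind_pmf \<mu> (glauber_step G \<kappa>)) f
      = (\<Sum>\<sigma>\<in>\<Omega>. pmf \<mu> \<sigma> *\<^sub>R expect_step f \<sigma>)"
    using finite_subset[OF set_glauber_step_subset finite_configurations]
    by (intro pmf_expectation_bind finite_configurations assms)
  also have "\<dots> = measure_pmf.expectation \<mu> (expect_step f)"
    using assms by (intro integral_measure_pmf[symmetric] finite_configurations) auto
  finally show ?thesis .
qed

lemma expect_step_eq:
  assumes "\<sigma> \<in> \<Omega>"
  shows "expect_step f \<sigma>
       = (\<Sum>v\<in>pverts G. measure_pmf.expectation (\<kappa> \<sigma> v (\<sigma> v)) (\<lambda>s. f (\<sigma>(v := s)))) / card (pverts G)"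
proof -
  have "expect_step f \<sigma> = (\<Sum>v\<in>pverts G. pmf (pmf_of_set (pverts G)) v *\<^sub>R
      measure_pmf.expectation (map_pmf (\<lambda>s. \<sigma>(v := s)) (\<kappa> \<sigma> v (\<sigma> v))) f)"
    unfolding glauber_step_def using finite_set_kernel[OF assms]
    by (intro pmf_expectation_bind) (auto simp: finite_verts sites_nonempty)
  then show ?thesis
    by (simp add: finite_verts sites_nonempty sum_divide_distrib)
qed

lemma pmf_glauber_step:
  "pmf (glauber_step G \<kappa> \<sigma>) \<tau>
   = (\<Sum>v\<in>pverts G. if \<forall>w. w \<noteq> v \<longrightarrow> \<tau> w = \<sigma> w then pmf (\<kappa> \<sigma> v (\<sigma> v)) (\<tau> v) else 0) / card (pverts G)"
  unfolding glauber_step_def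
  by (simp add: pmf_bind integral_pmf_of_set finite_verts sites_nonempty pmf_map_fun_upd)

text \<open>The term of \<open>v\<close> can be nonzero only if both configurations agree off
  \<open>v\<close>. This condition is symmetric, so reversibility at each site can be summed over
  all sites.\<close>

lemma detailed_balance:
  assumes "\<sigma> \<in> \<Omega>" "\<tau> \<in> \<Omega>"
  shows "pmf \<pi> \<sigma> * pmf (glauber_step G \<kappa> \<sigma>) \<tau> = pmf \<pi> \<tau> * pmf (glauber_step G \<kappa> \<tau>) \<sigma>"
proof -
  have "pmf \<pi> \<sigma> * (if \<forall>w. w \<noteq> v \<longrightarrow> \<tau> w = \<sigma> w then pmf (\<kappa> \<sigma> v (\<sigma> v)) (\<tau> v) else 0)
      = pmf \<pi> \<tau> * (if \<forall>w. w \<noteq> v \<longrightarrow> \<sigma> w = \<tau> w then pmf (\<kappa> \<tau> v (\<tau> v)) (\<sigma> v) else 0)"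
    if "v \<in> pverts G" for v
    using reversible[OF assms that] by auto
  then show ?thesis
    unfolding pmf_glauber_step by (simp add: sum_distrib_left)
qed

lemma stationary: "bind_pmf \<pi> (glauber_step G \<kappa>) = \<pi>"
proof (rule pmf_eqI)
  fix \<tau>
  show "pmf (bind_pmf \<pi> (glauber_step G \<kappa>)) \<tau> = pmf \<pi> \<tau>"
  proof (cases "\<tau> \<in> \<Omega>")
    case True
    have "pmf (bind_pmf \<pi> (glauber_step G \<kappa>)) \<tau>
        = (\<Sum>\<sigma>\<in>\<Omega>. pmf \<pi> \<sigma> * pmf (glauber_step G \<kappa> \<sigma>) \<tau>)"
      unfolding pmf_bind using finite_configurations support
      by (subst integral_measure_pmf[of \<Omega>]) auto
    also have "\<dots> = (\<Sum>\<sigma>\<in>\<Omega>. pmf \<pi> \<tau> * pmf (glauber_step G \<kappa> \<tau>) \<sigma>)"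
      using True by (intro sum.cong refl detailed_balance)
    also have "\<dots> = pmf \<pi> \<tau>"
      using True sum_pmf_eq_1[OF finite_configurations set_glauber_step_subset]
      by (simp flip: sum_distrib_left)
    finally show ?thesis .
  next
    case False
    then have "\<tau> \<notin> set_pmf (bind_pmf \<pi> (glauber_step G \<kappa>))"
      using set_glauber_step_subset support by auto
    then show ?thesis using False support by (metis pmf_eq_0_set_pmf)
  qed
qed

text \<open>The last step of the chain is moved onto the test function: \<open>f\<close> becomes
  \<open>expect_step f\<close>, whose Lipschitz constant gains the factor \<open>r\<close> and whose
  mean under \<open>\<pi>\<close> is the same by stationarity. Hence the induction on
  \<open>t\<close> generalises \<open>f\<close> and \<open>L\<close>; at \<open>t = 0\<close> the
  diameter \<open>D\<close> bounds the difference.\<close>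

theorem expectation_dist_contract:
  assumes contract: "\<And>f L. site_lipschitz (pverts G) \<Omega> w L f \<Longrightarrow> site_lipschitz (pverts G) \<Omega> w (r * L) (expect_step f)"
    and diam: "\<And>f L \<sigma> \<tau>. site_lipschitz (pverts G) \<Omega> w L f \<Longrightarrow> \<sigma> \<in> \<Omega> \<Longrightarrow> \<tau> \<in> \<Omega> \<Longrightarrow> \<bar>f \<sigma> - f \<tau>\<bar> \<le> L * D"
    and "\<sigma> \<in> \<Omega>" and "site_lipschitz (pverts G) \<Omega> w L f"
  shows "\<bar>measure_pmf.expectation (glauber_dist G \<kappa> \<sigma> t) f - measure_pmf.expectation \<pi> f\<bar> \<le> r ^ t * L * D"
  using assms(4)
proof (induction t arbitrary: f L)
  case 0
  have "\<bar>measure_pmf.expectation \<pi> (\<lambda>_. f \<sigma>) - measure_pmf.expectation \<pi> f\<bar>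
      \<le> measure_pmf.expectation \<pi> (\<lambda>_. L * D)"
    using diam[OF 0 \<open>\<sigma> \<in> \<Omega>\<close>] finite_configurations support by (intro abs_expectation_diff_le) auto
  then show ?case by (simp add: glauber_dist_def)
next
  case (Suc t)
  have "measure_pmf.expectation \<pi> f = measure_pmf.expectation \<pi> (expect_step f)"
    using expectation_bind_step[of \<pi> f] stationary support by simp
  then show ?case
    using Suc.IH[OF contract[OF Suc.prems]] set_glauber_dist_subset[OF \<open>\<sigma> \<in> \<Omega>\<close>]
    by (simp add: glauber_dist_Suc expectation_bind_step algebra_simps)
qed

theorem mixing_time_le:
  assumes contract: "\<And>f L. site_lipschitz (pverts G) \<Omega> w L f \<Longrightarrow> site_lipschitz (pverts G) \<Omega> w (r * L) (expect_step f)"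
    and diam: "\<And>f L \<sigma> \<tau>. site_lipschitz (pverts G) \<Omega> w L f \<Longrightarrow> \<sigma> \<in> \<Omega> \<Longrightarrow> \<tau> \<in> \<Omega> \<Longrightarrow> \<bar>f \<sigma> - f \<tau>\<bar> \<le> L * D"
    and weights: "\<And>v. v \<in> pverts G \<Longrightarrow> 1 \<le> w v"
    and t: "r ^ t * D \<le> 1 / (2 * exp 1)"
  shows "mixing_time G \<Omega> \<kappa> \<pi> \<le> t"
proof -
  have "tv_dist \<Omega> (glauber_dist G \<kappa> \<sigma> t) \<pi> \<le> 1 / (2 * exp 1)" if \<sigma>: "\<sigma> \<in> \<Omega>" for \<sigma>
  proof -
    let ?\<mu> = "glauber_dist G \<kappa> \<sigma> t"
    \<comment> \<open>Half the sign of the difference is the test function whose expectations differ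
      by exactly the total variation distance. It oscillates by at most 1, so it has Lipschitz
      constant 1 for weights that are at least 1.\<close>
    define f where "f z = sgn (pmf ?\<mu> z - pmf \<pi> z) / 2" for z
    have "\<bar>f x - f y\<bar> \<le> 1" for x y
      by (simp add: f_def sgn_if)
    then have "site_lipschitz (pverts G) \<Omega> w 1 f"
      using weights by (auto simp: site_lipschitz_def intro: order_trans)
    then have contracted:
      "\<bar>measure_pmf.expectation ?\<mu> f - measure_pmf.expectation \<pi> f\<bar> \<le> r ^ t * 1 * D"
      using contract diam \<sigma> by (intro expectation_dist_contract)
    have expectation: "measure_pmf.expectation \<nu> f = (\<Sum>z\<in>\<Omega>. f z * pmf \<nu> z)"
      if "set_pmf \<nu> \<subseteq> \<Omega>" for \<nu>
      using that by (intro integral_measure_pmf_real finite_configurations) auto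
    have "tv_dist \<Omega> ?\<mu> \<pi> = (\<Sum>z\<in>\<Omega>. f z * (pmf ?\<mu> z - pmf \<pi> z))"
      by (auto simp: tv_dist_def f_def sum_distrib_left abs_sgn mult_ac intro!: sum.cong)
    also have "\<dots> = measure_pmf.expectation ?\<mu> f - measure_pmf.expectation \<pi> f"
      by (simp add: expectation set_glauber_dist_subset[OF \<sigma>] support right_diff_distrib sum_subtractf)
    also have "\<dots> \<le> r ^ t * D" using contracted by linarith
    finally show ?thesis using t by (rule order_trans)
  qed
  then show ?thesis
    unfolding mixing_time_def using finite_configurations configurations_nonempty
    by (auto intro: Least_le)
qed

end

section \<open>Pointer paths in a forest\<close>

text \<open>The uniform part gives every spin positive probability, as irreducibility demands. Its
  mass 1/16 is small enough that a child, twice as heavy as its parent, adds at most 2/16 = 1/8 to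
  the spread of a disagreement.\<close>

definition new_spin :: "nat \<Rightarrow> nat pmf" where
  "new_spin n = bind_pmf (bernoulli_pmf (1 / 16)) (\<lambda>b. if b then pmf_of_set {..n} else return_pmf 0)"

lemma set_new_spin [simp]: "set_pmf (new_spin n) = {..n}"
  by (auto simp: new_spin_def split: if_splits)

lemma expectation_new_spin_nonzero:
  fixes c :: real
  assumes "0 \<le> c"
  shows "measure_pmf.expectation (new_spin n) (\<lambda>s. if s = 0 then 0 else c) \<le> c / 16"
proof -
  have "measure_pmf.expectation (new_spin n) (\<lambda>s. if s = 0 then 0 else c)
      = measure_pmf.expectation (new_spin n) (\<lambda>s. c * indicator (- {0}) s)"
    by (intro Bochner_Integration.integral_cong) auto
  also have "\<dots> = c * (1 - pmf (new_spin n) 0)"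
    by (simp add: measure_pmf.prob_compl[of "{0}", simplified] Compl_eq_Diff_UNIV measure_pmf_single)
  also have "\<dots> \<le> c * (1 / 16)"
  proof (rule mult_left_mono[OF _ assms])
    have "15 / 16 \<le> pmf (new_spin n) 0"
      by (simp add: new_spin_def pmf_bind)
    then show "1 - pmf (new_spin n) 0 \<le> 1 / 16" by simp
  qed
  finally show ?thesis by simp
qed

text \<open>The test \<open>par v < v\<close> ensures termination for an arbitrary
  \<open>par\<close> and at the same time marks the roots.\<close>

fun depth :: "(nat \<Rightarrow> nat) \<Rightarrow> nat \<Rightarrow> nat" where
  "depth par v = (if par v < v then Suc (depth par (par v)) else 0)"

declare depth.simps [simp del]

lemma depth_child: "par v < v \<Longrightarrow> depth par v = Suc (depth par (par v))"
  and depth_root: "\<not> par v < v \<Longrightarrow> depth par v = 0"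
  by (simp_all add: depth.simps[of par v])

text \<open>
  The spin \<open>Suc c\<close> at \<open>v\<close> is a pointer to \<open>c\<close> and \<open>0\<close> is the empty spin; a pointer to a site that is
  not a child of \<open>v\<close> leads nowhere. A vertex \<open>v\<close> is a root iff \<open>\<not> par v < v\<close>.
\<close>

locale pointer_forest = pair_graph G
  for G :: "nat pair_pre_digraph" +
  fixes n :: nat and par :: "nat \<Rightarrow> nat"
  assumes verts: "pverts G = {..<n}"
    and n_pos: "0 < n"
    and par_arcs: "\<lbrakk>v < n; par v < v\<rbrakk> \<Longrightarrow> (v, par v) \<in> parcs G \<and> (par v, v) \<in> parcs G"
begin

definition active :: "(nat \<Rightarrow> nat) \<Rightarrow> nat \<Rightarrow> bool" where
  "active \<sigma> v \<longleftrightarrow> (par v < v \<longrightarrow> \<sigma> (par v) = Suc v)"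

text \<open>These are the sites that may take any spin: no occupied child relies on their pointer.
  The spin at the site itself does not enter.\<close>

definition free :: "(nat \<Rightarrow> nat) \<Rightarrow> nat \<Rightarrow> bool" where
  "free \<sigma> v \<longleftrightarrow> active \<sigma> v \<and> (\<forall>c<n. v < c \<and> par c = v \<longrightarrow> \<sigma> c = 0)"

definition configs :: "(nat \<Rightarrow> nat) set" where
  "configs = {\<sigma> \<in> {..<n} \<rightarrow>\<^sub>E {..n}. \<forall>v<n. \<sigma> v \<noteq> 0 \<longrightarrow> active \<sigma> v}"

definition kernel :: "(nat, nat) update_kernel" where
  "kernel \<sigma> v s = (if free \<sigma> v then new_spin n else return_pmf s)"

text \<open>The default \<open>undefined\<close> off the sites matches the extensional
  configurations.\<close>

definition stationary_dist :: "(nat \<Rightarrow> nat) pmf" where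
  "stationary_dist = cond_pmf (Pi_pmf {..<n} undefined (\<lambda>_. new_spin n)) configs"

definition unoccupied :: "nat \<Rightarrow> nat" where
  "unoccupied = (\<lambda>v\<in>{..<n}. 0)"

definition weight :: "nat \<Rightarrow> real" where
  "weight v = 2 ^ depth par v"

section \<open>Feasible configurations\<close>

lemma configs_PiE: "\<sigma> \<in> configs \<Longrightarrow> \<sigma> \<in> {..<n} \<rightarrow>\<^sub>E {..n}"
  and configs_le: "\<sigma> \<in> configs \<Longrightarrow> v < n \<Longrightarrow> \<sigma> v \<le> n"
  and configs_active: "\<sigma> \<in> configs \<Longrightarrow> v < n \<Longrightarrow> \<sigma> v \<noteq> 0 \<Longrightarrow> active \<sigma> v"
  unfolding configs_def by auto

lemma unoccupied_configs: "unoccupied \<in> configs"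
  by (auto simp: unoccupied_def configs_def)

text \<open>A change at \<open>v\<close> can only disturb the activity of children of
  \<open>v\<close>, and the children of a free site are empty.\<close>

lemma fun_upd_configs:
  assumes "\<sigma> \<in> configs" "v < n" "free \<sigma> v" "s \<le> n"
  shows "\<sigma>(v := s) \<in> configs"
proof -
  have "\<sigma>(v := s) \<in> {..<n} \<rightarrow>\<^sub>E {..n}"
    using configs_PiE[OF assms(1)] assms(2,4) by (auto simp: PiE_iff extensional_def)
  moreover have "active (\<sigma>(v := s)) u" if "u < n" "(\<sigma>(v := s)) u \<noteq> 0" for u
    using that assms configs_active[OF assms(1), of u]
    by (auto simp: active_def free_def split: if_splits)
  ultimately show ?thesis by (auto simp: configs_def)
qed

lemma kernel_feasible:
  assumes "\<sigma> \<in> configs" "v < n" "s \<in> set_pmf (kernel \<sigma> v (\<sigma> v))"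
  shows "\<sigma>(v := s) \<in> configs"
  using assms fun_upd_configs by (auto simp: kernel_def split: if_splits)

text \<open>The largest occupied site is free, because children are larger than their parents.\<close>

lemma configs_induct [consumes 1, case_names unoccupied occupy]:
  assumes "\<sigma> \<in> configs"
    and "P unoccupied"
    and "\<And>\<sigma> v. \<lbrakk>\<sigma> \<in> configs; v < n; free \<sigma> v; \<sigma> v \<noteq> 0; \<sigma>(v := 0) \<in> configs; P (\<sigma>(v := 0))\<rbrakk> \<Longrightarrow> P \<sigma>"
  shows "P \<sigma>"
  using assms(1)
proof (induction "card {v. v < n \<and> \<sigma> v \<noteq> 0}" arbitrary: \<sigma> rule: less_induct)
  case less
  let ?S = "{v. v < n \<and> \<sigma> v \<noteq> 0}"
  have fin: "finite ?S" by simp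
  show ?case
  proof (cases "?S = {}")
    case True
    then have "\<sigma> = unoccupied"
      using configs_PiE[OF less.prems] by (auto simp: unoccupied_def PiE_iff extensional_def fun_eq_iff)
    then show ?thesis using assms(2) by simp
  next
    case False
    define v where "v = Max ?S"
    have v: "v < n" "\<sigma> v \<noteq> 0" using Max_in[OF fin False] by (auto simp: v_def)
    have "\<sigma> c = 0" if "c < n" "v < c" for c
      using that Max_ge[OF fin, of c] by (fastforce simp: v_def)
    then have fr: "free \<sigma> v"
      using configs_active[OF less.prems v] by (auto simp: free_def)
    have \<sigma>': "\<sigma>(v := 0) \<in> configs" using fun_upd_configs less.prems v fr by simp
    have "card {u. u < n \<and> (\<sigma>(v := 0)) u \<noteq> 0} < card ?S"
      using v by (intro psubset_card_mono) auto
    then show ?thesis using assms(3) less.hyps \<sigma>' less.prems v fr by blast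
  qed
qed

text \<open>Serves nonredundancy. A path of pointers is built from the root down to
  \<open>v\<close>; keeping all larger sites empty leaves its last site free, so that its pointer
  can be redirected to prolong the path.\<close>

lemma ex_occupied_config: "v < n \<Longrightarrow> \<exists>\<sigma>\<in>configs. \<sigma> v \<noteq> 0 \<and> (\<forall>c. v < c \<and> c < n \<longrightarrow> \<sigma> c = 0)"
proof (induction v rule: less_induct)
  case (less v)
  show ?case
  proof (cases "par v < v")
    case False
    have "free unoccupied v"
      using False less.prems by (auto simp: free_def active_def unoccupied_def)
    \<comment> \<open>The spin \<open>1\<close> stands for any nonzero spin; it is available because
      \<open>0 < n\<close>.\<close>
    then have "unoccupied(v := 1) \<in> configs"
      using fun_upd_configs[OF unoccupied_configs less.prems, of 1] n_pos by simp
    then show ?thesis by (intro bexI[of _ "unoccupied(v := 1)"]) (auto simp: unoccupied_def)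
  next
    case True
    then obtain \<sigma> where \<sigma>: "\<sigma> \<in> configs" "\<sigma> (par v) \<noteq> 0"
        and tail: "\<And>c. par v < c \<Longrightarrow> c < n \<Longrightarrow> \<sigma> c = 0"
      using less by (meson less_trans)
    have "free \<sigma> (par v)"
      using configs_active[OF \<sigma>(1) _ \<sigma>(2)] True less.prems tail by (auto simp: free_def)
    then have \<sigma>': "\<sigma>(par v := Suc v) \<in> configs"
      using fun_upd_configs[OF \<sigma>(1)] True less.prems by simp
    have "free (\<sigma>(par v := Suc v)) v"
      using True tail by (auto simp: free_def active_def)
    then have "\<sigma>(par v := Suc v, v := 1) \<in> configs"
      using fun_upd_configs[OF \<sigma>'] less.prems n_pos by simp
    then show ?thesis
      using True tail by (intro bexI[of _ "\<sigma>(par v := Suc v, v := 1)"]) auto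
  qed
qed

section \<open>Irreducibility\<close>

lemma set_step:
  "set_pmf (glauber_step G kernel \<sigma>) = (\<Union>v<n. (\<lambda>s. \<sigma>(v := s)) ` set_pmf (kernel \<sigma> v (\<sigma> v)))"
  unfolding glauber_step_def using verts n_pos by (subst set_bind_pmf) (auto simp: set_pmf_of_set lessThan_empty_iff)

text \<open>An update of site \<open>0\<close> may leave it alone: a free site can redraw its
  current spin since \<open>new_spin\<close> has full support, and any other site keeps its spin.
  This holding gives aperiodicity.\<close>

lemma stay_in_step: "\<sigma> \<in> configs \<Longrightarrow> \<sigma> \<in> set_pmf (glauber_step G kernel \<sigma>)"
  using n_pos configs_le[of \<sigma> 0] unfolding set_step
  by (intro UN_I[of 0] image_eqI[of _ _ "\<sigma> 0"]) (auto simp: kernel_def)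

lemma fun_upd_in_step:
  "\<lbrakk>v < n; free \<sigma> v; s \<le> n\<rbrakk> \<Longrightarrow> \<sigma>(v := s) \<in> set_pmf (glauber_step G kernel \<sigma>)"
  unfolding set_step by (auto simp: kernel_def)

definition reach :: "(nat \<Rightarrow> nat) \<Rightarrow> (nat \<Rightarrow> nat) \<Rightarrow> bool" where
  "reach = (\<lambda>\<sigma> \<tau>. \<tau> \<in> set_pmf (glauber_step G kernel \<sigma>))\<^sup>*\<^sup>*"

lemma reach_imp_dist_pos: "reach \<sigma> \<tau> \<Longrightarrow> \<exists>t. 0 < pmf (glauber_dist G kernel \<sigma> t) \<tau>"
  unfolding reach_def pmf_positive_iff
proof (induction rule: rtranclp_induct)
  case base
  show ?case by (rule exI[of _ 0]) (simp add: glauber_dist_def)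
next
  case (step \<rho> \<tau>)
  then obtain t where "\<rho> \<in> set_pmf (glauber_dist G kernel \<sigma> t)" by blast
  with step(2) have "\<tau> \<in> set_pmf (glauber_dist G kernel \<sigma> (Suc t))"
    by (auto simp: glauber_dist_def)
  then show ?case by blast
qed

text \<open>Both configurations are joined through \<open>unoccupied\<close>: the first is emptied
  from the deep end of its paths, and the second is filled by reversing such an emptying.\<close>

lemma reach_configs:
  assumes "\<sigma> \<in> configs" "\<tau> \<in> configs"
  shows "reach \<sigma> \<tau>"
proof -
  have "reach \<sigma> unoccupied" using assms(1)
  proof (induction rule: configs_induct)
    case unoccupied
    show ?case by (simp add: reach_def)
  next
    case (occupy \<sigma> v)
    then have "\<sigma>(v := 0) \<in> set_pmf (glauber_step G kernel \<sigma>)" using fun_upd_in_step by simp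
    then show ?case using occupy(6) unfolding reach_def by (rule converse_rtranclp_into_rtranclp)
  qed
  moreover have "reach unoccupied \<tau>" using assms(2)
  proof (induction rule: configs_induct)
    case unoccupied
    show ?case by (simp add: reach_def)
  next
    case (occupy \<tau> v)
    \<comment> \<open>Freeness of \<open>v\<close> does not depend on the spin at \<open>v\<close>,
      so the removal can be undone in one step.\<close>
    have "free (\<tau>(v := 0)) v" using occupy(3) by (auto simp: free_def active_def)
    then have "\<tau> \<in> set_pmf (glauber_step G kernel (\<tau>(v := 0)))"
      using fun_upd_in_step[of v "\<tau>(v := 0)" "\<tau> v"] occupy(1,2) configs_le by simp
    then show ?case using occupy(6) unfolding reach_def by (rule rtranclp.rtrancl_into_rtrancl[rotated])
  qed
  ultimately show ?thesis unfolding reach_def by simp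
qed

text \<open>One of the two configurations occupies \<open>u\<close>, so \<open>u\<close> is active
  there, and activity is read off the common parent spin. An occupied child of \<open>u\<close> is
  also common to both and would force the same pointer at \<open>u\<close>.\<close>

lemma free_differing_site:
  assumes "\<sigma> \<in> configs" "\<tau> \<in> configs" "u < n" "\<And>v. v \<noteq> u \<Longrightarrow> \<sigma> v = \<tau> v" "\<sigma> u \<noteq> \<tau> u"
  shows "free \<sigma> u"
proof -
  have par: "active \<sigma> u \<longleftrightarrow> active \<tau> u"
    using assms(4)[of "par u"] by (auto simp: active_def)
  have "active \<sigma> u"
    using configs_active[OF assms(1,3)] configs_active[OF assms(2,3)] assms(5) par by fastforce
  moreover have "\<sigma> c = 0" if c: "c < n" "u < c" "par c = u" for c
  proof (rule ccontr)
    assume "\<sigma> c \<noteq> 0"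
    then have "\<sigma> u = Suc c" "\<tau> u = Suc c"
      using configs_active[OF assms(1) c(1)] configs_active[OF assms(2) c(1)] c assms(4)[of c]
      by (auto simp: active_def)
    then show False using assms(5) by simp
  qed
  ultimately show ?thesis by (auto simp: free_def)
qed

section \<open>The conditioned product measure and reversibility\<close>

lemma stationary_dist_pos: "set_pmf (Pi_pmf {..<n} undefined (\<lambda>_. new_spin n)) \<inter> configs = configs"
  using configs_PiE by (fastforce simp: set_Pi_pmf PiE_dflt_def PiE_iff extensional_def)

lemma set_stationary_dist: "set_pmf stationary_dist = configs"
  unfolding stationary_dist_def
  using stationary_dist_pos unoccupied_configs by (subst set_cond_pmf) auto

lemma pmf_stationary_dist:
  "\<exists>Z. \<forall>\<sigma>\<in>configs. pmf stationary_dist \<sigma> = (\<Prod>v<n. pmf (new_spin n) (\<sigma> v)) / Z"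
proof -
  let ?p = "Pi_pmf {..<n} undefined (\<lambda>_. new_spin n)"
  have "pmf stationary_dist \<sigma> = (\<Prod>v<n. pmf (new_spin n) (\<sigma> v)) / measure_pmf.prob ?p configs"
    if "\<sigma> \<in> configs" for \<sigma>
    unfolding stationary_dist_def using stationary_dist_pos unoccupied_configs that configs_PiE[OF that]
    by (subst pmf_cond) (auto simp: pmf_Pi PiE_iff extensional_def)
  then show ?thesis by blast
qed

text \<open>If the spins at \<open>v\<close> differ, \<open>v\<close> is free in both
  configurations, so both updates draw from \<open>new_spin\<close>. Each side is then the product
  of the two \<open>new_spin\<close> probabilities at \<open>v\<close> and the common factors of the
  other sites.\<close>

lemma kernel_reversible:
  assumes "\<sigma> \<in> configs" "\<tau> \<in> configs" "v < n" "\<And>w. w \<noteq> v \<Longrightarrow> \<tau> w = \<sigma> w"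
  shows "pmf stationary_dist \<sigma> * pmf (kernel \<sigma> v (\<sigma> v)) (\<tau> v)
       = pmf stationary_dist \<tau> * pmf (kernel \<tau> v (\<tau> v)) (\<sigma> v)"
proof (cases "\<sigma> v = \<tau> v")
  case True
  then have "\<sigma> = \<tau>" using assms(4) by (metis ext)
  then show ?thesis by simp
next
  case False
  have "free \<sigma> v" "free \<tau> v"
    using free_differing_site[OF assms(1,2,3)] free_differing_site[OF assms(2,1,3)] assms(4) False by auto
  moreover obtain Z where Z: "\<And>\<rho>. \<rho> \<in> configs \<Longrightarrow>
      pmf stationary_dist \<rho> = (\<Prod>v<n. pmf (new_spin n) (\<rho> v)) / Z"
    using pmf_stationary_dist by blast
  moreover have "(\<Prod>u<n. pmf (new_spin n) (\<rho> u))
      = pmf (new_spin n) (\<rho> v) * (\<Prod>u\<in>{..<n} - {v}. pmf (new_spin n) (\<rho> u))" for \<rho>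
    using assms(3) by (intro prod.remove) auto
  moreover have "(\<Prod>u\<in>{..<n} - {v}. pmf (new_spin n) (\<tau> u)) = (\<Prod>u\<in>{..<n} - {v}. pmf (new_spin n) (\<sigma> u))"
    using assms(4) by (intro prod.cong) auto
  ultimately show ?thesis using assms(1,2) by (simp add: kernel_def mult_ac)
qed

lemma free_local:
  assumes "v < n" "\<And>w. (v, w) \<in> parcs G \<Longrightarrow> \<sigma> w = \<tau> w"
  shows "free \<sigma> v \<longleftrightarrow> free \<tau> v"
proof -
  have "\<sigma> (par v) = \<tau> (par v)" if "par v < v"
    using par_arcs[OF assms(1) that] assms(2) by blast
  moreover have "\<sigma> c = \<tau> c" if "c < n" "v < c" "par c = v" for c
    using par_arcs[of c] that assms(2) by blast
  ultimately show ?thesis unfolding free_def active_def by metis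
qed

sublocale glauber_dynamics G "{..n}" configs kernel stationary_dist
proof unfold_locales
  show "pverts G \<noteq> {}" using verts n_pos by auto
  show "configs \<subseteq> pverts G \<rightarrow>\<^sub>E {..n}" using configs_PiE verts by auto
  show "\<sigma>(v := s) \<in> configs"
    if "\<sigma> \<in> configs" "v \<in> pverts G" "s \<in> set_pmf (kernel \<sigma> v (\<sigma> v))" for \<sigma> v s
    using that kernel_feasible verts by simp
  show "kernel \<sigma> v (\<sigma> v) = kernel \<tau> v (\<tau> v)"
    if "\<sigma> \<in> configs" "\<tau> \<in> configs" "v \<in> pverts G" "\<sigma> v = \<tau> v"
      "\<And>w. (v, w) \<in> parcs G \<Longrightarrow> \<sigma> w = \<tau> w" for \<sigma> \<tau> v
    using free_local[of v \<sigma> \<tau>] that verts by (simp add: kernel_def)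
  show "pmf stationary_dist \<sigma> * pmf (kernel \<sigma> v (\<sigma> v)) (\<tau> v)
      = pmf stationary_dist \<tau> * pmf (kernel \<tau> v (\<tau> v)) (\<sigma> v)"
    if "\<sigma> \<in> configs" "\<tau> \<in> configs" "v \<in> pverts G" "\<And>w. w \<noteq> v \<Longrightarrow> \<tau> w = \<sigma> w" for \<sigma> \<tau> v
    using kernel_reversible that verts by simp
  show "\<exists>t. 0 < pmf (glauber_dist G kernel \<sigma> t) \<tau>" if "\<sigma> \<in> configs" "\<tau> \<in> configs" for \<sigma> \<tau>
    using that by (intro reach_imp_dist_pos reach_configs)
  show "Gcd {t. 0 < pmf (glauber_dist G kernel \<sigma> t) \<tau>} = 1"
    if \<sigma>: "\<sigma> \<in> configs" and \<tau>: "\<tau> \<in> configs" for \<sigma> \<tau>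
  proof -
    let ?T = "{t. 0 < pmf (glauber_dist G kernel \<sigma> t) \<tau>}"
    obtain t where t: "t \<in> ?T" using reach_imp_dist_pos[OF reach_configs[OF \<sigma> \<tau>]] by blast
    \<comment> \<open>Holding at \<open>\<tau>\<close> for one step yields two consecutive times, so
      the gcd divides 1.\<close>
    then have "Suc t \<in> ?T"
      using stay_in_step[OF \<tau>] by (auto simp: glauber_dist_def pmf_positive_iff)
    with t have "Gcd ?T dvd Suc t - t" by (intro dvd_diff_nat Gcd_dvd)
    then show ?thesis by simp
  qed
  show "\<exists>\<sigma>\<in>configs. \<exists>\<tau>\<in>configs. \<sigma> v \<noteq> \<tau> v" if "v \<in> pverts G" for v
    using ex_occupied_config[of v] unoccupied_configs that verts by (force simp: unoccupied_def)
qed (auto simp: set_stationary_dist)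

section \<open>Weights and the weighted diameter\<close>

lemma weight_ge_1: "1 \<le> weight v"
  by (simp add: weight_def)

lemma weight_child: "par v < v \<Longrightarrow> weight v = 2 * weight (par v)"
  by (simp add: weight_def depth_child)

text \<open>The Lipschitz bound is applied to a configuration compared with itself.\<close>

lemma lipschitz_nonneg: "site_lipschitz (pverts G) configs weight L f \<Longrightarrow> 0 \<le> L"
  using site_lipschitzD[of "pverts G" configs weight L f unoccupied unoccupied 0]
    unoccupied_configs verts n_pos weight_ge_1[of 0] by (simp add: zero_le_mult_iff)

text \<open>Emptying the occupied sites one at a time costs \<open>L\<close> times their total
  weight. The factor 2 comes from passing from \<open>\<sigma>\<close> to \<open>\<tau>\<close>
  through \<open>unoccupied\<close>.\<close>

lemma lipschitz_diam:
  assumes lip: "site_lipschitz (pverts G) configs weight L f"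
    and bound: "\<And>\<sigma>. \<sigma> \<in> configs \<Longrightarrow> (\<Sum>v | v < n \<and> \<sigma> v \<noteq> 0. weight v) \<le> M"
    and "\<sigma> \<in> configs" "\<tau> \<in> configs"
  shows "\<bar>f \<sigma> - f \<tau>\<bar> \<le> L * (2 * M)"
proof -
  have "\<bar>f \<sigma> - f unoccupied\<bar> \<le> L * (\<Sum>v | v < n \<and> \<sigma> v \<noteq> 0. weight v)" if "\<sigma> \<in> configs" for \<sigma>
    using that
  proof (induction rule: configs_induct)
    case unoccupied
    have "{v. v < n \<and> unoccupied v \<noteq> 0} = {}" by (auto simp: unoccupied_def)
    then show ?case by (simp only: sum.empty mult_zero_right diff_self abs_zero order_refl)
  next
    case (occupy \<sigma> v)
    have "{u. u < n \<and> \<sigma> u \<noteq> 0} = insert v {u. u < n \<and> (\<sigma>(v := 0)) u \<noteq> 0}"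
      using occupy by auto
    then have "(\<Sum>u | u < n \<and> \<sigma> u \<noteq> 0. weight u) = weight v + (\<Sum>u | u < n \<and> (\<sigma>(v := 0)) u \<noteq> 0. weight u)"
      by (simp add: sum.insert_if)
    moreover have "\<bar>f \<sigma> - f (\<sigma>(v := 0))\<bar> \<le> L * weight v"
      using occupy verts by (intro site_lipschitzD[OF lip]) auto
    ultimately show ?case using occupy.IH by (simp only: distrib_left)
  qed
  then have "\<bar>f \<sigma> - f unoccupied\<bar> \<le> L * M" if "\<sigma> \<in> configs" for \<sigma>
    using bound[OF that] lipschitz_nonneg[OF lip] that by (meson mult_left_mono order_trans)
  from this[OF assms(3)] this[OF assms(4)] show ?thesis by (simp add: algebra_simps)
qed

section \<open>Spread and healing of one disagreement\<close>

abbreviation expect_site :: "((nat \<Rightarrow> nat) \<Rightarrow> real) \<Rightarrow> nat \<Rightarrow> (nat \<Rightarrow> nat) \<Rightarrow> real" where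
  "expect_site f v \<sigma> \<equiv> measure_pmf.expectation (kernel \<sigma> v (\<sigma> v)) (\<lambda>s. f (\<sigma>(v := s)))"

lemma expect_site_not_free: "\<not> free \<sigma> v \<Longrightarrow> expect_site f v \<sigma> = f \<sigma>"
  by (simp add: kernel_def)

lemma expect_site_free: "free \<sigma> v \<Longrightarrow> expect_site f v \<sigma> = measure_pmf.expectation (new_spin n) (\<lambda>s. f (\<sigma>(v := s)))"
  by (simp add: kernel_def)

lemma expect_site_diff_le:
  assumes h: "\<And>s. s \<le> n \<Longrightarrow> \<bar>f (\<sigma>(v := s)) - a\<bar> \<le> h s"
    and fr: "free \<sigma> v"
  shows "\<bar>expect_site f v \<sigma> - a\<bar> \<le> measure_pmf.expectation (new_spin n) h"
  using abs_expectation_diff_le[of "new_spin n" "\<lambda>s. f (\<sigma>(v := s))" "\<lambda>_. a" h] h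
  unfolding expect_site_free[OF fr] by simp

text \<open>
  A site whose update is enabled in only one of two configurations differing at \<open>u\<close> is the parent
  of \<open>u\<close>, which has half the weight of \<open>u\<close>, or a child of \<open>u\<close>, which has twice that weight but is
  unoccupied before the update and stays so with probability at least \<open>15/16\<close>.
\<close>

lemma expect_site_lipschitz_one_free:
  assumes lip: "site_lipschitz (pverts G) configs weight L f"
    and conf: "\<sigma> \<in> configs" "\<tau> \<in> configs" and u: "u < n" "\<And>v. v \<noteq> u \<Longrightarrow> \<sigma> v = \<tau> v"
    and v: "v < n" "v \<noteq> u" and fr: "free \<sigma> v" "\<not> free \<tau> v"
  shows "\<bar>expect_site f v \<sigma> - expect_site f v \<tau>\<bar>
    \<le> L * weight u * (1 + (if v = par u then 1/2 else 0) + (if \<sigma> u = Suc v then 1/8 else 0))"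
proof -
  have L: "0 \<le> L" using lipschitz_nonneg[OF lip] .
  have near: "\<bar>f \<sigma> - f \<tau>\<bar> \<le> L * weight u"
    using conf u verts by (intro site_lipschitzD[OF lip]) auto
  have move: "\<bar>f (\<sigma>(v := s)) - f \<sigma>\<bar> \<le> L * weight v" if "s \<le> n" for s
    using fun_upd_configs[OF conf(1) v(1) fr(1) that] conf verts v
    by (intro site_lipschitzD[OF lip]) auto
  consider (parent) "par u = v" "v < u" | (child) "par v = u" "u < v" "\<sigma> u = Suc v" "\<tau> u \<noteq> Suc v"
    using fr u(2) v(2) unfolding free_def active_def by metis
  then show ?thesis
  proof cases
    case parent
    have "\<bar>expect_site f v \<sigma> - f \<tau>\<bar> \<le> measure_pmf.expectation (new_spin n) (\<lambda>s. L * weight u + L * weight v)"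
      using near move by (intro expect_site_diff_le[OF _ fr(1)]) (smt (verit))
    also have "\<dots> = L * weight u * (1 + 1 / 2)"
      using parent weight_child[of u] by (simp add: algebra_simps)
    also have "\<dots> \<le> L * weight u * (1 + (if v = par u then 1/2 else 0) + (if \<sigma> u = Suc v then 1/8 else 0))"
      using parent L weight_ge_1[of u] by (intro mult_left_mono) auto
    finally show ?thesis unfolding expect_site_not_free[OF fr(2)] .
  next
    case child
    \<comment> \<open>The child is not pointed to in \<open>\<tau>\<close>, hence empty there, and
      \<open>\<sigma>\<close> agrees with \<open>\<tau>\<close> at \<open>v\<close>. Drawing the
      empty spin therefore changes nothing.\<close>
    have "\<tau> v = 0"
      using configs_active[OF conf(2) v(1)] child by (auto simp: active_def)
    then have "\<sigma> v = 0" using u(2) v(2) by simp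
    then have stay: "\<sigma>(v := 0) = \<sigma>" by auto
    have "\<bar>expect_site f v \<sigma> - f \<tau>\<bar>
        \<le> measure_pmf.expectation (new_spin n) (\<lambda>s. L * weight u + (if s = 0 then 0 else L * weight v))"
    proof (rule expect_site_diff_le[OF _ fr(1)])
      show "\<bar>f (\<sigma>(v := s)) - f \<tau>\<bar> \<le> L * weight u + (if s = 0 then 0 else L * weight v)" if "s \<le> n" for s
        using near move[OF that] stay by auto
    qed
    also have "\<dots> = L * weight u + measure_pmf.expectation (new_spin n) (\<lambda>s. if s = 0 then 0 else L * weight v)"
      by (subst Bochner_Integration.integral_add) (auto intro: integrable_measure_pmf_finite)
    also have "\<dots> \<le> L * weight u + L * weight v / 16"
      using expectation_new_spin_nonzero[of "L * weight v" n] L weight_ge_1[of v] by simp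
    also have "L * weight v / 16 = L * weight u * (1 / 8)"
      using weight_child[of v] child by simp
    also have "L * weight u + L * weight u * (1 / 8) = L * weight u * (1 + 1 / 8)"
      by (simp add: algebra_simps)
    also have "\<dots> \<le> L * weight u * (1 + (if v = par u then 1/2 else 0) + (if \<sigma> u = Suc v then 1/8 else 0))"
      using child L weight_ge_1[of u] by (intro mult_left_mono) auto
    finally show ?thesis unfolding expect_site_not_free[OF fr(2)] .
  qed
qed

text \<open>Equal spins are drawn in both configurations. An update at \<open>u\<close> itself, free
  in both, removes the disagreement. An update enabled in both or in neither leaves it at
  \<open>u\<close> at cost 1. If only one is enabled, the site is the parent of \<open>u\<close>
  (extra 1/2) or a child named by one of the two pointers at \<open>u\<close> (extra 1/8).\<close>

lemma expect_site_lipschitz: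
  assumes lip: "site_lipschitz (pverts G) configs weight L f"
    and conf: "\<sigma> \<in> configs" "\<tau> \<in> configs" and u: "u < n" "\<And>v. v \<noteq> u \<Longrightarrow> \<sigma> v = \<tau> v"
    and ne: "\<sigma> u \<noteq> \<tau> u" and v: "v < n"
  shows "\<bar>expect_site f v \<sigma> - expect_site f v \<tau>\<bar>
    \<le> L * weight u * ((if v = u then 0 else 1) + (if v = par u then 1/2 else 0)
        + (if \<sigma> u = Suc v then 1/8 else 0) + (if \<tau> u = Suc v then 1/8 else 0))" (is "_ \<le> L * weight u * ?c")
proof -
  have Lw: "0 \<le> L * weight u" using lipschitz_nonneg[OF lip] weight_ge_1[of u] by simp
  have mono: "L * weight u * a \<le> L * weight u * b" if "a \<le> b" for a b
    using Lw that by (rule mult_left_mono[rotated])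
  consider "v = u" | "v \<noteq> u" "free \<sigma> v" "free \<tau> v" | "v \<noteq> u" "\<not> free \<sigma> v" "\<not> free \<tau> v"
    | "v \<noteq> u" "free \<sigma> v" "\<not> free \<tau> v" | "v \<noteq> u" "free \<tau> v" "\<not> free \<sigma> v" by blast
  then show ?thesis
  proof cases
    case 1
    have eq: "\<sigma>(v := s) = \<tau>(v := s)" for s using u(2) 1 by auto
    have fr: "free \<sigma> v" "free \<tau> v"
      using free_differing_site[OF conf u(1)] free_differing_site[OF conf(2,1) u(1)] u(2) ne 1 by auto
    have "expect_site f v \<sigma> = expect_site f v \<tau>"
      unfolding expect_site_free[OF fr(1)] expect_site_free[OF fr(2)] by (simp only: eq)
    then show ?thesis using mono[of 0 ?c] by simp
  next
    case 2
    have "\<bar>expect_site f v \<sigma> - expect_site f v \<tau>\<bar> \<le> measure_pmf.expectation (new_spin n) (\<lambda>_. L * weight u)"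
      unfolding expect_site_free[OF 2(2)] expect_site_free[OF 2(3)]
    proof (rule abs_expectation_diff_le)
      show "\<bar>f (\<sigma>(v := s)) - f (\<tau>(v := s))\<bar> \<le> L * weight u" if "s \<in> set_pmf (new_spin n)" for s
        using that fun_upd_configs conf v 2 u verts by (intro site_lipschitzD[OF lip]) auto
    qed simp
    then show ?thesis using mono[of 1 ?c] 2(1) by simp
  next
    case 3
    have "\<bar>f \<sigma> - f \<tau>\<bar> \<le> L * weight u"
      using conf u verts by (intro site_lipschitzD[OF lip]) auto
    then show ?thesis using mono[of 1 ?c] 3 by (simp add: expect_site_not_free)
  next
    case 4
    have "\<bar>expect_site f v \<sigma> - expect_site f v \<tau>\<bar>
        \<le> L * weight u * (1 + (if v = par u then 1/2 else 0) + (if \<sigma> u = Suc v then 1/8 else 0))"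
      using u(2) by (intro expect_site_lipschitz_one_free[OF lip conf u(1) _ v 4])
    also have "\<dots> \<le> L * weight u * ?c"
      using 4(1) by (intro mono) auto
    finally show ?thesis .
  next
    case 5
    have "\<bar>expect_site f v \<sigma> - expect_site f v \<tau>\<bar> = \<bar>expect_site f v \<tau> - expect_site f v \<sigma>\<bar>"
      by (rule abs_minus_commute)
    also have "\<dots> \<le> L * weight u * (1 + (if v = par u then 1/2 else 0) + (if \<tau> u = Suc v then 1/8 else 0))"
      using u(2) by (intro expect_site_lipschitz_one_free[OF lip conf(2,1) u(1) _ v 5]) simp
    also have "\<dots> \<le> L * weight u * ?c"
      using 5(1) by (intro mono) auto
    finally show ?thesis .
  qed
qed

text \<open>Summing the site bounds gives at most \<open>n - 1 + 1/2 + 1/8 + 1/8 = n - 1/4\<close>,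
  which is divided by \<open>n\<close>.\<close>

theorem expect_step_contract:
  assumes lip: "site_lipschitz (pverts G) configs weight L f"
  shows "site_lipschitz (pverts G) configs weight ((1 - 1 / (4 * n)) * L) (expect_step f)"
  unfolding site_lipschitz_def
proof (intro ballI impI)
  fix \<sigma> \<tau> u
  assume conf: "\<sigma> \<in> configs" "\<tau> \<in> configs" and "u \<in> pverts G" and "\<forall>v. v \<noteq> u \<longrightarrow> \<sigma> v = \<tau> v"
  then have u: "u < n" "\<And>v. v \<noteq> u \<Longrightarrow> \<sigma> v = \<tau> v" using verts by auto
  have Lw: "0 \<le> L * weight u" using lipschitz_nonneg[OF lip] weight_ge_1[of u] by simp
  show "\<bar>expect_step f \<sigma> - expect_step f \<tau>\<bar> \<le> (1 - 1 / (4 * n)) * L * weight u"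
  proof (cases "\<sigma> u = \<tau> u")
    case True
    then have "\<sigma> = \<tau>" using u(2) by (metis ext)
    moreover have "1 / (4 * real n) \<le> 1" using n_pos by simp
    ultimately show ?thesis using Lw by (simp add: mult.assoc)
  next
    case False
    let ?c = "\<lambda>v. (if v = u then 0 else 1) + (if v = par u then 1/2 else 0)
        + (if \<sigma> u = Suc v then 1/8 else 0) + (if \<tau> u = Suc v then 1/8 else 0) :: real"
    \<comment> \<open>A pointer names at most one site, so however many children \<open>u\<close>
      has, each configuration contributes 1/8 once.\<close>
    have delta: "(\<Sum>v<n. if a = Suc v then 1/8 else 0 :: real) \<le> 1/8" for a
      by (cases a) (simp_all add: sum.delta)
    have "(\<Sum>v<n. if v = u then 0 else 1 :: real) = (\<Sum>v\<in>{..<n} - {u}. 1)"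
      by (subst sum.remove[of _ u]) (use u(1) in \<open>auto intro!: sum.cong\<close>)
    also have "\<dots> = real n - 1" using u(1) by (simp add: of_nat_diff)
    finally have "sum ?c {..<n} \<le> real n - 1 / 4"
      using delta[of "\<sigma> u"] delta[of "\<tau> u"] by (simp add: sum.distrib sum.delta)
    then have c: "L * weight u * (\<Sum>v<n. ?c v) \<le> L * weight u * (real n - 1 / 4)"
      using Lw by (rule mult_left_mono)
    have "\<bar>expect_step f \<sigma> - expect_step f \<tau>\<bar> = \<bar>\<Sum>v<n. expect_site f v \<sigma> - expect_site f v \<tau>\<bar> / n"
      by (simp add: expect_step_eq conf verts sum_subtractf flip: diff_divide_distrib)
    also have "\<dots> \<le> (\<Sum>v<n. L * weight u * ?c v) / n"
      using expect_site_lipschitz[OF lip conf u False]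
      by (intro divide_right_mono order_trans[OF sum_abs sum_mono]) auto
    also have "\<dots> \<le> L * weight u * (real n - 1 / 4) / n"
      unfolding sum_distrib_left[symmetric] using c by (intro divide_right_mono) simp_all
    also have "\<dots> = (1 - 1 / (4 * n)) * L * weight u"
      using n_pos by (simp add: field_simps)
    finally show ?thesis .
  qed
qed

text \<open>By \<open>1 - x \<le> exp (- x)\<close>, after \<open>4 * n * ln (4 * exp 1 * M)\<close>
  steps the contraction factor is at most \<open>1 / (4 * exp 1 * M)\<close>; times the diameter
  \<open>2 * M\<close> this is the threshold \<open>1 / (2 * exp 1)\<close>. The summand 1 pays for
  rounding up.\<close>

theorem mixing_time_forest_le:
  assumes "\<And>\<sigma>. \<sigma> \<in> configs \<Longrightarrow> (\<Sum>v | v < n \<and> \<sigma> v \<noteq> 0. weight v) \<le> M" and "1 \<le> M"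
  shows "real (mixing_time G configs kernel stationary_dist) \<le> 4 * n * ln (4 * exp 1 * M) + 1"
proof -
  have n: "1 \<le> real n" using n_pos by simp
  let ?x = "4 * n * ln (4 * exp 1 * M)"
  define t where "t = nat \<lceil>?x\<rceil>"
  have t: "?x \<le> t" unfolding t_def by linarith
  have "(1 - 1 / (4 * n)) ^ t \<le> exp (- 1 / (4 * n)) ^ t"
    using n exp_ge_add_one_self[of "- 1 / (4 * n)"] by (intro power_mono) (auto simp: field_simps)
  also have "\<dots> = exp (- (t / (4 * n)))"
    by (simp flip: exp_of_nat_mult)
  also have "\<dots> \<le> exp (- ln (4 * exp 1 * M))"
    using t n by (simp add: field_simps)
  also have "\<dots> = 1 / (4 * exp 1 * M)"
    using assms(2) by (simp add: exp_minus field_simps)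
  finally have "(1 - 1 / (4 * n)) ^ t * (2 * M) \<le> 1 / (4 * exp 1 * M) * (2 * M)"
    using assms(2) by (intro mult_right_mono) auto
  also have "\<dots> = 1 / (2 * exp 1)" using assms(2) by simp
  finally have "mixing_time G configs kernel stationary_dist \<le> t"
    using expect_step_contract lipschitz_diam[OF _ assms(1)] weight_ge_1 by (intro mixing_time_le)
  moreover have "0 \<le> ?x"
  proof -
    have "1 * 1 \<le> exp 1 * M" using assms(2) by (intro mult_mono) simp_all
    then show ?thesis by simp
  qed
  then have "t \<le> ?x + 1" unfolding t_def by linarith
  ultimately show ?thesis by linarith
qed

end

section \<open>Total weight of the occupied path in a tree\<close>

context pointer_forest
begin

text \<open>The parents of two occupied sites of equal depth are occupied and again of equal depth,
  hence equal by induction; their single pointer then names both sites. At depth 0 the only root is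
  \<open>0\<close>.\<close>

lemma inj_depth_occupied:
  assumes tree: "\<And>v. v < n \<Longrightarrow> \<not> par v < v \<Longrightarrow> v = 0" and \<sigma>: "\<sigma> \<in> configs"
  shows "inj_on (depth par) {v. v < n \<and> \<sigma> v \<noteq> 0}"
proof -
  have "u = v" if "u < n" "v < n" "\<sigma> u \<noteq> 0" "\<sigma> v \<noteq> 0" "depth par u = depth par v" for u v
    using that
  proof (induction u arbitrary: v rule: less_induct)
    case (less u)
    show ?case
    proof (cases "par u < u")
      case True
      then have v: "par v < v"
        using less.prems(5) depth_child[of par u] depth_child[of par v]
          depth_root[of par u] depth_root[of par v]
        by linarith
      have \<sigma>_par: "\<sigma> (par u) = Suc u" "\<sigma> (par v) = Suc v"
        using configs_active[OF \<sigma>] less.prems True v by (auto simp: active_def)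
      have "depth par (par u) = depth par (par v)"
        using less.prems(5) True v by (simp add: depth_child)
      then have "par u = par v"
        using less.prems(1,2) True v \<sigma>_par by - (rule less.IH, simp_all)
      then show ?thesis using \<sigma>_par by (metis nat.inject)
    next
      case False
      then have "\<not> par v < v"
        using less.prems(5) depth_child[of par u] depth_child[of par v]
          depth_root[of par u] depth_root[of par v]
        by linarith
      then show ?thesis using False tree less.prems(1,2) by metis
    qed
  qed
  then show ?thesis by (auto simp: inj_on_def)
qed

text \<open>Each depth carries at most one occupied site, so the weights are bounded by a geometric
  sum.\<close>

lemma sum_weight_tree_le:
  assumes tree: "\<And>v. v < n \<Longrightarrow> \<not> par v < v \<Longrightarrow> v = 0" and \<sigma>: "\<sigma> \<in> configs"
    and D: "\<And>v. v < n \<Longrightarrow> depth par v \<le> D"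
  shows "(\<Sum>v | v < n \<and> \<sigma> v \<noteq> 0. weight v) \<le> 2 ^ Suc D"
proof -
  have "(\<Sum>v | v < n \<and> \<sigma> v \<noteq> 0. weight v) = (\<Sum>d\<in>depth par ` {v. v < n \<and> \<sigma> v \<noteq> 0}. 2 ^ d)"
    using inj_depth_occupied[OF tree \<sigma>] by (simp add: sum.reindex weight_def)
  also have "\<dots> \<le> (\<Sum>d\<le>D. 2 ^ d)"
    using D by (intro sum_mono2) auto
  also have "\<dots> \<le> 2 ^ Suc D"
    using sum_gp0[of "2::real" D] by simp
  finally show ?thesis .
qed

end

section \<open>Balanced trees of maximum degree \<open>b + 1\<close>\<close>

text \<open>
  Truncated subtraction makes \<open>1, \<dots>, b + 1\<close> the children of the root \<open>0\<close>. The root thus has one child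
  more than the other vertices, which makes up for its missing parent in the degree.
\<close>

definition tree_par :: "nat \<Rightarrow> nat \<Rightarrow> nat" where
  "tree_par b v = (v - 2) div b"

definition tree_graph :: "nat \<Rightarrow> nat \<Rightarrow> nat pair_pre_digraph" where
  "tree_graph b n = \<lparr> pverts = {..<n},
     parcs = (\<Union>v\<in>{0<..<n}. {(v, tree_par b v), (tree_par b v, v)}) \<rparr>"

lemma tree_par_less: "0 < v \<Longrightarrow> tree_par b v < v"
  unfolding tree_par_def by (meson div_le_dividend diff_less le_less_trans zero_less_numeral)

lemma tree_par_neq [simp]: "0 < v \<Longrightarrow> tree_par b v \<noteq> v" "0 < v \<Longrightarrow> v \<noteq> tree_par b v"
  using tree_par_less[of v b] by auto

lemma tree_par_not_less: "\<not> tree_par b v < v \<Longrightarrow> v = 0"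
  using tree_par_less by blast

lemma pair_graph_tree: "pair_graph (tree_graph b n)"
  by unfold_locales
    (auto simp: tree_graph_def symmetric_def arcs_ends_def arc_to_ends_def intro!: symI dest: tree_par_less
      intro: less_trans[OF tree_par_less])

lemma out_degree_tree:
  "out_degree (with_proj (tree_graph b n)) v
   = card ({w. 0 < w \<and> w < n \<and> tree_par b w = v} \<union> {w. 0 < v \<and> v < n \<and> w = tree_par b v})" (is "_ = card ?N")
proof -
  have "out_arcs (with_proj (tree_graph b n)) v = Pair v ` ?N"
    by (auto simp: out_arcs_def tree_graph_def)
  then show ?thesis by (simp add: out_degree_def card_image inj_on_def)
qed

text \<open>The root attains the maximum with its \<open>b + 1\<close> children, all present because
  \<open>Suc b < n\<close>. Any other vertex has its parent and at most \<open>b\<close> children,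
  which lie in an interval of length \<open>b\<close>.\<close>

lemma max_degree_tree:
  assumes "1 \<le> b" "Suc b < n"
  shows "max_degree (tree_graph b n) = Suc b"
proof -
  have "{w. 0 < w \<and> w < n \<and> tree_par b w = 0} = {1..Suc b}"
    using assms by (auto simp: tree_par_def div_eq_0_iff)
  then have root: "out_degree (with_proj (tree_graph b n)) 0 = Suc b"
    unfolding out_degree_tree by simp
  have other: "out_degree (with_proj (tree_graph b n)) v \<le> Suc b" if "0 < v" for v
  proof -
    have "w \<in> {b * v + 2..<b * v + 2 + b}" if "tree_par b w = v" for w
    proof -
      have "b * v \<le> w - 2" "w - 2 < b * v + b"
        using that assms(1) times_div_less_eq_dividend[of b "w - 2"] dividend_less_times_div[of b "w - 2"]
        by (auto simp: tree_par_def)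
      \<comment> \<open>Positivity excludes \<open>w < 2\<close>, so \<open>w - 2\<close> is a
        genuine difference.\<close>
      moreover have "0 < b * v" using assms(1) \<open>0 < v\<close> by simp
      ultimately show ?thesis unfolding atLeastLessThan_iff by linarith
    qed
    then have "{w. 0 < w \<and> w < n \<and> tree_par b w = v} \<union> {w. 0 < v \<and> v < n \<and> w = tree_par b v}
        \<subseteq> insert (tree_par b v) {b * v + 2..<b * v + 2 + b}" by auto
    then have "out_degree (with_proj (tree_graph b n)) v \<le> card (insert (tree_par b v) {b * v + 2..<b * v + 2 + b})"
      unfolding out_degree_tree by (intro card_mono) auto
    also have "\<dots> \<le> Suc b" using card_insert_le_m1[of "Suc b" "{b * v + 2..<b * v + 2 + b}"] by simp
    finally show ?thesis .
  qed
  show ?thesis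
    unfolding max_degree_def
  proof (rule Max_eqI)
    show "finite (out_degree (with_proj (tree_graph b n)) ` pverts (tree_graph b n))"
      by (simp add: tree_graph_def)
    show "y \<le> Suc b" if "y \<in> out_degree (with_proj (tree_graph b n)) ` pverts (tree_graph b n)" for y
      using that root other by (metis gr0I imageE order_refl)
    show "Suc b \<in> out_degree (with_proj (tree_graph b n)) ` pverts (tree_graph b n)"
      using root assms by (intro image_eqI[of _ _ 0]) (auto simp: tree_graph_def)
  qed
qed

text \<open>The bound reproduces itself: the parent \<open>p\<close> of \<open>v > 0\<close>
  satisfies \<open>b * p + 1 \<le> v\<close>, even for \<open>v = 1\<close>, where truncation gives
  \<open>p = 0\<close>. The summand 1 is what the root needs.\<close>

lemma power_depth_tree_le: "1 \<le> b \<Longrightarrow> b ^ depth (tree_par b) v \<le> b * v + 1"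
proof (induction v rule: less_induct)
  case (less v)
  show ?case
  proof (cases "v = 0")
    case True
    then show ?thesis by (simp add: depth_root)
  next
    case False
    then have par: "tree_par b v < v" by (simp add: tree_par_less)
    have "b * tree_par b v \<le> v - 2"
      unfolding tree_par_def by (rule times_div_less_eq_dividend)
    then have "b * tree_par b v + 1 \<le> v" using False by linarith
    then have "b ^ depth (tree_par b) (tree_par b v) \<le> v"
      using less.IH[OF par less.prems] by linarith
    then show ?thesis using par by (simp add: depth_child le_SucI)
  qed
qed

section \<open>Mixing times on the tree graphs\<close>

lemma pointer_forest_tree: "0 < n \<Longrightarrow> pointer_forest (tree_graph b n) n (tree_par b)"
  by (intro pointer_forest.intro pair_graph_tree pointer_forest_axioms.intro)
    (force simp: tree_graph_def intro: gr0I)+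

text \<open>For the identity \<open>par v < v\<close> never holds, so every site is a root and the
  same graph carries independent sites.\<close>

lemma pointer_forest_singletons: "0 < n \<Longrightarrow> pointer_forest (tree_graph b n) n (\<lambda>v. v)"
  by (intro pointer_forest.intro pair_graph_tree pointer_forest_axioms.intro)
    (auto simp: tree_graph_def)

text \<open>From \<open>b ^ d \<le> b * n\<close> and \<open>b \<le> n\<close> follows
  \<open>d * ln b \<le> 2 * ln n\<close>. A second factor 2 comes from
  \<open>Suc b \<le> b ^ 2\<close>, which uses \<open>2 \<le> b\<close>.\<close>

lemma tree_depth_le:
  assumes "2 \<le> b" "Suc b < n" "v < n"
  shows "depth (tree_par b) v * ln (Suc b) \<le> 4 * ln n"
proof -
  let ?d = "depth (tree_par b) v"
  have "b * v + 1 \<le> b * Suc v" using assms(1) by simp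
  also have "\<dots> \<le> b * n" using assms(3) by (intro mult_left_mono) auto
  finally have "b ^ ?d \<le> b * n" using power_depth_tree_le[of b v] assms(1) by linarith
  then have "real b ^ ?d \<le> real b * n" by (metis of_nat_le_iff of_nat_mult of_nat_power)
  then have "ln (real b ^ ?d) \<le> ln (real b * n)"
    using assms by (subst ln_le_cancel_iff) auto
  then have "?d * ln b \<le> ln b + ln n"
    using assms by (simp add: ln_realpow ln_mult)
  also have "\<dots> \<le> 2 * ln n" using assms by simp
  finally have d: "?d * ln b \<le> 2 * ln n" .
  have "Suc b \<le> b ^ 2" using assms(1) by (cases b) (auto simp: power2_eq_square)
  then have "real (Suc b) \<le> real b ^ 2" by (metis of_nat_le_iff of_nat_power)
  then have "ln (real (Suc b)) \<le> ln (real b ^ 2)" using assms(1) by (subst ln_le_cancel_iff) auto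
  also have "\<dots> = 2 * ln b" using assms(1) by (simp add: ln_realpow)
  finally have "?d * ln (Suc b) \<le> ?d * (2 * ln b)" by (intro mult_left_mono) auto
  then show ?thesis using d by simp
qed

text \<open>With \<open>M = 2 ^ Suc D\<close> the logarithm is at most \<open>D + 4\<close>, so the
  time is at most \<open>n * (4 * D + 17)\<close>. In units of \<open>ln n / ln (Suc b)\<close>,
  which is at least 1, this is \<open>16 + 17 = 33\<close> per site.\<close>

theorem tree_mixing_time_le:
  assumes "2 \<le> b" "Suc b < n"
  shows "real (mixing_time (tree_graph b n) (pointer_forest.configs n (tree_par b))
      (pointer_forest.kernel n (tree_par b)) (pointer_forest.stationary_dist n (tree_par b)))
    \<le> 33 * n * ln n / ln (Suc b)"
proof -
  interpret pointer_forest "tree_graph b n" n "tree_par b"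
    using assms by (intro pointer_forest_tree) simp
  define D where "D = Max (depth (tree_par b) ` {..<n})"
  have depth_le: "depth (tree_par b) v \<le> D" if "v < n" for v
    using that by (simp add: D_def)
  have "D \<in> depth (tree_par b) ` {..<n}"
    unfolding D_def using n_pos by (intro Max_in) auto
  then have D: "D * ln (Suc b) \<le> 4 * ln n" using tree_depth_le[OF assms] by auto
  have pos: "0 < ln (Suc b)" "ln (Suc b) \<le> ln n" using assms by auto
  have "real (mixing_time (tree_graph b n) configs kernel stationary_dist)
      \<le> 4 * n * ln (4 * exp 1 * 2 ^ Suc D) + 1"
  proof (rule mixing_time_forest_le)
    show "(\<Sum>v | v < n \<and> \<sigma> v \<noteq> 0. weight v) \<le> 2 ^ Suc D" if "\<sigma> \<in> configs" for \<sigma>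
      using tree_par_not_less that depth_le by (rule sum_weight_tree_le)
    show "(1::real) \<le> 2 ^ Suc D" by (rule one_le_power) simp
  qed
  also have "ln (4 * exp 1 * 2 ^ Suc D) = ln ((2::real) ^ (D + 3) * exp 1)"
    by (simp add: power_add mult_ac)
  also have "\<dots> = (D + 3) * ln 2 + 1"
    by (subst ln_mult) (simp_all add: ln_realpow del: power_add)
  also have "\<dots> \<le> real D + 4"
    using mult_left_mono[of "ln 2" 1 "real D + 3"] ln_2_less_1 by (simp add: algebra_simps)
  finally have "real (mixing_time (tree_graph b n) configs kernel stationary_dist) \<le> n * (4 * D + 17)"
    using n_pos by (simp add: algebra_simps mult_left_mono)
  also have "\<dots> \<le> n * (33 * ln n / ln (Suc b))"
    using D pos unfolding of_nat_mult by (intro mult_left_mono) (simp_all add: pos_le_divide_eq algebra_simps)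
  finally show ?thesis by (simp add: mult_ac)
qed

text \<open>All weights are 1, so \<open>M = n\<close>. Since \<open>ln n \<ge> 1\<close>, the bound
  \<open>13 + 4 * ln n\<close> is below \<open>33 * ln n\<close>, and dividing by
  \<open>ln 2 < 1\<close> only enlarges it.\<close>

theorem singletons_mixing_time_le:
  assumes "3 \<le> n"
  shows "real (mixing_time (tree_graph b n) (pointer_forest.configs n (\<lambda>v. v))
      (pointer_forest.kernel n (\<lambda>v. v)) (pointer_forest.stationary_dist n (\<lambda>v. v)))
    \<le> 33 * n * ln n / ln 2"
proof -
  interpret pointer_forest "tree_graph b n" n "\<lambda>v. v"
    using assms by (intro pointer_forest_singletons) simp
  have "exp 1 \<le> real n" using exp_le assms by linarith
  then have ln_n: "1 \<le> ln (real n)" using assms by (subst ln_ge_iff) auto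
  have "(\<Sum>v | v < n \<and> \<sigma> v \<noteq> 0. weight v) \<le> real n" if "\<sigma> \<in> configs" for \<sigma>
  proof -
    have "card {v. v < n \<and> \<sigma> v \<noteq> 0} \<le> card {..<n}" by (intro card_mono) auto
    then show ?thesis by (simp add: weight_def depth_root)
  qed
  moreover have "1 \<le> real n" using assms by simp
  ultimately have "real (mixing_time (tree_graph b n) configs kernel stationary_dist) \<le> 4 * n * ln (4 * exp 1 * n) + 1"
    by (rule mixing_time_forest_le)
  also have "ln (4 * exp 1 * real n) = ln (2 ^ 2) + 1 + ln n"
    using assms by (simp add: ln_mult)
  also have "\<dots> \<le> 3 + ln n"
    using ln_2_less_1 by (subst ln_realpow) auto
  finally have "real (mixing_time (tree_graph b n) configs kernel stationary_dist) \<le> n * (13 + 4 * ln n)"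
    using n_pos by (simp add: algebra_simps mult_left_mono)
  also have "\<dots> \<le> n * (33 * ln n)"
    using ln_n by (intro mult_left_mono) auto
  also have "\<dots> \<le> n * (33 * ln n) / ln 2"
    using ln_n ln_2_less_1 by (simp add: pos_le_divide_eq mult_left_le)
  finally show ?thesis by (simp add: mult_ac)
qed

theorem theorem1p2:
  shows "\<exists>C::real. \<forall>\<Delta>::nat \<Rightarrow> nat. (\<forall>n\<ge>3. 2 \<le> \<Delta> n \<and> \<Delta> n < n) \<longrightarrow>
    (\<exists>(G :: nat \<Rightarrow> nat pair_pre_digraph). \<forall>n\<ge>3.
       pair_graph (G n) \<and> card (pverts (G n)) = n \<and> max_degree (G n) = \<Delta> n \<and>
       (\<exists>(Q :: nat set) (\<Omega> :: (nat \<Rightarrow> nat) set) \<kappa> \<pi>.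
          glauber_dynamics (G n) Q \<Omega> \<kappa> \<pi> \<and>
          real (mixing_time (G n) \<Omega> \<kappa> \<pi>) \<le> C * real n * ln (real n) / ln (real (\<Delta> n))))"
proof (intro exI[of _ 33] allI impI)
  fix \<Delta> :: "nat \<Rightarrow> nat"
  assume \<Delta>: "\<forall>n\<ge>3. 2 \<le> \<Delta> n \<and> \<Delta> n < n"
  show "\<exists>(G :: nat \<Rightarrow> nat pair_pre_digraph). \<forall>n\<ge>3.
       pair_graph (G n) \<and> card (pverts (G n)) = n \<and> max_degree (G n) = \<Delta> n \<and>
       (\<exists>(Q :: nat set) (\<Omega> :: (nat \<Rightarrow> nat) set) \<kappa> \<pi>.
          glauber_dynamics (G n) Q \<Omega> \<kappa> \<pi> \<and>
          real (mixing_time (G n) \<Omega> \<kappa> \<pi>) \<le> 33 * real n * ln (real n) / ln (real (\<Delta> n)))"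
  proof (intro exI[of _ "\<lambda>n. tree_graph (\<Delta> n - 1) n"] allI impI conjI)
    fix n :: nat
    assume n: "3 \<le> n"
    define b where "b = \<Delta> n - 1"
    have b: "\<Delta> n = Suc b" "1 \<le> b" "Suc b < n" using \<Delta> n by (auto simp: b_def)
    show "pair_graph (tree_graph (\<Delta> n - 1) n)" by (rule pair_graph_tree)
    show "card (pverts (tree_graph (\<Delta> n - 1) n)) = n" by (simp add: tree_graph_def)
    show "max_degree (tree_graph (\<Delta> n - 1) n) = \<Delta> n" using max_degree_tree b by simp
    \<comment> \<open>For \<open>b = 1\<close> the graph is a path, whose depth is linear in
      \<open>n\<close>; there the independent sites replace the pointer paths.\<close>
    let ?par = "if b = 1 then \<lambda>v. v else tree_par b"
    interpret pointer_forest "tree_graph b n" n ?par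
      using pointer_forest_tree pointer_forest_singletons n by simp
    have "real (mixing_time (tree_graph b n) configs kernel stationary_dist) \<le> 33 * n * ln n / ln (Suc b)"
      using singletons_mixing_time_le[OF n, of b] tree_mixing_time_le[of b n] b by (cases "b = 1") auto
    then show "\<exists>Q \<Omega> \<kappa> \<pi>. glauber_dynamics (tree_graph (\<Delta> n - 1) n) (Q :: nat set) \<Omega> \<kappa> \<pi> \<and>
        real (mixing_time (tree_graph (\<Delta> n - 1) n) \<Omega> \<kappa> \<pi>) \<le> 33 * real n * ln (real n) / ln (real (\<Delta> n))"
      using glauber_dynamics_axioms b by auto
  qed
qed

end
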